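(* Let $G=(V,E)$ be a finite graph with $n$ vertices and maximum degree $\Delta$. Run the Decentralized Coloring algorithm on $G$, but with the initial coloring $\chi_0:V\to\{1,\dots,\Delta+1\}$ chosen by an adversary and with the conflicted vertex recolored at each step chosen by an adversary (possibly depending on the history). Then, for every such adversary, the algorithm converges to a proper coloring with colors in $\{1,\dots,\Delta+1\}$ after $O(n\Delta)$ recolorings in expectation.
   Context: A vertex $v$ is conflicted under a coloring $\chi$ if some neighbor $u$ of $v$ has $\chi(u)=\chi(v)$. The Decentralized Coloring algorithm maintains a coloring $\chi_t:V\to\{1,\dots,\Delta+1\}$: starting from an initial coloring $\chi_0$, at each time step some currently conflicted vertex $v$ is selected and $v$ changes its color once to an independent uniformly random color in $\{1,\dots,\Delta+1\}$ (one recoloring); this repeats until no vertex is conflicted. In the standard version $\chi_0$ is uniformly random and $v$ is uniformly random among conflicted vertices; here both choices are made by an adversary, and the only randomness is in the new colors. The expectation is over the random new colors. *)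

theory Defs
  imports "HOL-Probability.Probability" "Graph_Theory.Pair_Digraph"
begin

text \<open>
  Finite simple undirected graphs are the \<open>pair_graph\<close>s of the AFP entry Graph Theory, i.e.
  finite loop-free symmetric digraphs. Every edge is present in both directions, so the degree of a
  vertex is its out-degree.
\<close>

definition max_degree :: "'a pair_pre_digraph \<Rightarrow> nat" where
  "max_degree G = Max (insert 0 (out_degree (with_proj G) ` pverts G))"

definition palette :: "'a pair_pre_digraph \<Rightarrow> nat set" where
  "palette G = {1..max_degree G + 1}"

text \<open>Only the values of a coloring on \<open>pverts G\<close> matter.\<close>

definition coloring :: "'a pair_pre_digraph \<Rightarrow> ('a \<Rightarrow> nat) \<Rightarrow> bool" where
  "coloring G \<phi> \<longleftrightarrow> (\<forall>v\<in>pverts G. \<phi> v \<in> palette G)"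

definition proper_coloring :: "'a pair_pre_digraph \<Rightarrow> ('a \<Rightarrow> nat) \<Rightarrow> bool" where
  "proper_coloring G \<phi> \<longleftrightarrow> coloring G \<phi> \<and> (\<forall>(u, v)\<in>parcs G. \<phi> u \<noteq> \<phi> v)"

definition conflicted :: "'a pair_pre_digraph \<Rightarrow> ('a \<Rightarrow> nat) \<Rightarrow> 'a set" where
  "conflicted G \<phi> = {v \<in> pverts G. \<exists>u. (v, u) \<in> parcs G \<and> \<phi> u = \<phi> v}"

text \<open>
  A history lists, in chronological order, the recolorings \<open>(v, c)\<close> performed so far:
  vertex \<open>v\<close> received the new color \<open>c\<close>.
\<close>

type_synonym 'a history = "('a \<times> nat) list"

definition coloring_after :: "('a \<Rightarrow> nat) \<Rightarrow> 'a history \<Rightarrow> 'a \<Rightarrow> nat" where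
  "coloring_after \<phi>\<^sub>0 h = foldl (\<lambda>\<phi> (v, c). \<phi>(v := c)) \<phi>\<^sub>0 h"

text \<open>
  An adversary maps the history to the next vertex to be recolored. It is legal from \<open>\<phi>\<^sub>0\<close> if it
  selects a conflicted vertex as long as there is one; its value is irrelevant otherwise.
\<close>

type_synonym 'a adversary = "'a history \<Rightarrow> 'a"

definition legal_adversary ::
    "'a pair_pre_digraph \<Rightarrow> ('a \<Rightarrow> nat) \<Rightarrow> 'a adversary \<Rightarrow> bool" where
  "legal_adversary G \<phi>\<^sub>0 \<sigma> \<longleftrightarrow>
     (\<forall>h. conflicted G (coloring_after \<phi>\<^sub>0 h) \<noteq> {} \<longrightarrow>
          \<sigma> h \<in> conflicted G (coloring_after \<phi>\<^sub>0 h))"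

text \<open>
  The run is driven by the stream \<open>\<omega>\<close> of new colors. Once no vertex is conflicted, it stops: the
  history no longer changes.
\<close>

primrec run ::
    "'a pair_pre_digraph \<Rightarrow> ('a \<Rightarrow> nat) \<Rightarrow> 'a adversary \<Rightarrow> nat stream \<Rightarrow> nat \<Rightarrow> 'a history" where
  "run G \<phi>\<^sub>0 \<sigma> \<omega> 0 = []"
| "run G \<phi>\<^sub>0 \<sigma> \<omega> (Suc t) =
     (let h = run G \<phi>\<^sub>0 \<sigma> \<omega> t
      in if conflicted G (coloring_after \<phi>\<^sub>0 h) = {} then h else h @ [(\<sigma> h, \<omega> !! t)])"

definition coloring_at ::
    "'a pair_pre_digraph \<Rightarrow> ('a \<Rightarrow> nat) \<Rightarrow> 'a adversary \<Rightarrow> nat stream \<Rightarrow> nat \<Rightarrow> 'a \<Rightarrow> nat" where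
  "coloring_at G \<phi>\<^sub>0 \<sigma> \<omega> t = coloring_after \<phi>\<^sub>0 (run G \<phi>\<^sub>0 \<sigma> \<omega> t)"

text \<open>The total number of recolorings, which is \<open>\<infinity>\<close> if the run never stops.\<close>

definition recolorings ::
    "'a pair_pre_digraph \<Rightarrow> ('a \<Rightarrow> nat) \<Rightarrow> 'a adversary \<Rightarrow> nat stream \<Rightarrow> ennreal" where
  "recolorings G \<phi>\<^sub>0 \<sigma> \<omega> = (SUP t. of_nat (length (run G \<phi>\<^sub>0 \<sigma> \<omega> t)))"

text \<open>The law of a sequence of independent uniformly random colors.\<close>

definition color_stream :: "'a pair_pre_digraph \<Rightarrow> nat stream measure" where
  "color_stream G = stream_space (measure_pmf (pmf_of_set (palette G)))"

end

theory Submission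
  imports Defs
begin

text \<open>
  The potential is \<open>n - \<kappa>\<close>, where \<open>\<kappa>\<close> is the number of components of the graph of
  monochromatic edges. Deleting a conflicted vertex \<open>v\<close> does not decrease the number of components
  (although \<open>v\<close> itself disappears), and putting it back with color \<open>c\<close> merges it with at most as
  many components as \<open>v\<close> has neighbors of color \<open>c\<close>. On average over the \<open>\<Delta> + 1\<close> colors there
  are at most \<open>\<Delta> / (\<Delta> + 1)\<close> such neighbors, so each recoloring decreases the potential
  by at least \<open>1 / (\<Delta> + 1)\<close> in expectation. It starts below \<open>n\<close>, hence at most
  \<open>n (\<Delta> + 1) \<le> 2 n \<Delta>\<close> recolorings are expected; if \<open>\<Delta> = 0\<close>, there are none.
\<close>

subsection \<open>Components of the monochromatic graph\<close>

definition mono_labelling ::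
    "'a pair_pre_digraph \<Rightarrow> 'a set \<Rightarrow> ('a \<Rightarrow> nat) \<Rightarrow> ('a \<Rightarrow> nat) \<Rightarrow> bool" where
  "mono_labelling G W \<phi> f \<longleftrightarrow>
     (\<forall>(x, y)\<in>parcs G. x \<in> W \<longrightarrow> y \<in> W \<longrightarrow> \<phi> x = \<phi> y \<longrightarrow> f x = f y)"

text \<open>
  The number of components is encoded as the largest number of labels in a labelling that is
  constant along the monochromatic edges; this avoids handling connectivity.
\<close>

definition mono_components :: "'a pair_pre_digraph \<Rightarrow> 'a set \<Rightarrow> ('a \<Rightarrow> nat) \<Rightarrow> nat" where
  "mono_components G W \<phi> = Max {card (f ` W) | f. mono_labelling G W \<phi> f}"

text \<open>The number of edges of a spanning forest of the monochromatic graph.\<close>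

definition defect :: "'a pair_pre_digraph \<Rightarrow> ('a \<Rightarrow> nat) \<Rightarrow> nat" where
  "defect G \<phi> = card (pverts G) - mono_components G (pverts G) \<phi>"

lemma finite_label_counts:
  assumes "finite W"
  shows "finite {card (f ` W) | f. mono_labelling G W \<phi> f}"
  by (rule finite_subset[of _ "{..card W}"]) (auto intro: card_image_le assms)

lemma mono_components_ge:
  assumes "finite W" "mono_labelling G W \<phi> f"
  shows "card (f ` W) \<le> mono_components G W \<phi>"
  unfolding mono_components_def using assms by (auto intro!: Max_ge finite_label_counts)

lemma mono_components_obtain:
  assumes "finite W"
  obtains f where "mono_labelling G W \<phi> f" "mono_components G W \<phi> = card (f ` W)"
proof -
  have "mono_labelling G W \<phi> (\<lambda>_. 0)"
    by (simp add: mono_labelling_def)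
  then have "mono_components G W \<phi> \<in> {card (f ` W) | f. mono_labelling G W \<phi> f}"
    unfolding mono_components_def by (intro Max_in finite_label_counts assms) auto
  then show thesis using that by auto
qed

lemma mono_components_le_card:
  assumes "finite W"
  shows "mono_components G W \<phi> \<le> card W"
  by (metis assms card_image_le mono_components_obtain)

section \<open>Effect of one recoloring on the components\<close>

context pair_graph
begin

lemma conflicted_subset: "conflicted G \<phi> \<subseteq> pverts G"
  by (auto simp: conflicted_def)

text \<open>A neighbor of the same color carries the label of \<open>v\<close>, so an optimal
  labelling loses no label when \<open>v\<close> is dropped.\<close>

lemma mono_components_delete_conflicted:
  assumes v: "v \<in> conflicted G \<phi>"
  shows "mono_components G (pverts G) \<phi> \<le> mono_components G (pverts G - {v}) \<phi>"
proof -
  obtain f where f: "mono_labelling G (pverts G) \<phi> f"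
    "mono_components G (pverts G) \<phi> = card (f ` pverts G)"
    using mono_components_obtain[OF pair_finite_verts] .
  obtain u where u: "(v, u) \<in> parcs G" "\<phi> u = \<phi> v" "v \<in> pverts G"
    using v by (auto simp: conflicted_def)
  have "u \<in> pverts G" "u \<noteq> v"
    using u pair_no_loops[of "(v, u)"] by (auto dest: in_arcsD2)
  moreover have "f v = f u"
    using f(1) u \<open>u \<in> pverts G\<close> by (auto simp: mono_labelling_def)
  ultimately have "f ` pverts G = f ` (pverts G - {v})"
    by (auto simp: image_iff)
  moreover have "mono_labelling G (pverts G - {v}) \<phi> f"
    using f(1) by (auto simp: mono_labelling_def)
  ultimately show ?thesis
    using f(2) mono_components_ge[of "pverts G - {v}" G \<phi> f] pair_finite_verts by simp
qed

text \<open>In an optimal labelling away from \<open>v\<close>, all classes meeting the neighbors of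
  color \<open>c\<close> are fused with \<open>v\<close> under a fresh label: one label is gained,
  and at most one is lost per such neighbor.\<close>

lemma mono_components_insert:
  assumes v: "v \<in> pverts G"
  shows "mono_components G (pverts G - {v}) \<phi> + 1
    \<le> mono_components G (pverts G) (\<phi>(v := c)) + card {u. (v, u) \<in> parcs G \<and> \<phi> u = c}"
proof -
  let ?W = "pverts G - {v}"
  define N where "N = {u. (v, u) \<in> parcs G \<and> \<phi> u = c}"
  have fin: "finite ?W" "finite N"
    using pair_finite_verts by (auto simp: N_def intro: finite_subset[of _ "pverts G"] dest: in_arcsD2)
  obtain f where f: "mono_labelling G ?W \<phi> f" "mono_components G ?W \<phi> = card (f ` ?W)"
    using mono_components_obtain[OF fin(1)] .
  obtain a where a: "a \<notin> f ` ?W"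
    using fin(1) ex_new_if_finite[of "f ` ?W"] by auto
  define g where "g x = (if x = v \<or> f x \<in> f ` N then a else f x)" for x
  have "g x = g y" if xy: "(x, y) \<in> parcs G" "(\<phi>(v := c)) x = (\<phi>(v := c)) y" for x y
  proof -
    \<comment> \<open>\<open>N\<close> is defined by arcs out of \<open>v\<close>, so the case
      \<open>y = v\<close> needs the reversed arc.\<close>
    have "x \<noteq> y" "(y, x) \<in> parcs G" "x \<in> pverts G" "y \<in> pverts G"
      using xy pair_no_loops[of "(x, y)"] arcs_symmetric by (auto dest: in_arcsD1 in_arcsD2)
    then show ?thesis
      using xy f(1) by (cases "x = v"; cases "y = v") (auto simp: g_def N_def mono_labelling_def)
  qed
  then have "mono_labelling G (pverts G) (\<phi>(v := c)) g"
    unfolding mono_labelling_def by blast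
  then have "card (g ` pverts G) \<le> mono_components G (pverts G) (\<phi>(v := c))"
    by (rule mono_components_ge[OF pair_finite_verts])
  moreover have "insert a (f ` ?W - f ` N) \<subseteq> g ` pverts G"
  proof -
    have "a = g v" by (simp add: g_def)
    moreover have "f x = g x" if "x \<noteq> v" "f x \<notin> f ` N" for x
      using that by (simp add: g_def)
    ultimately show ?thesis using v by blast
  qed
  then have "card (insert a (f ` ?W - f ` N)) \<le> card (g ` pverts G)"
    using pair_finite_verts by (intro card_mono) auto
  moreover have "card (insert a (f ` ?W - f ` N)) = Suc (card (f ` ?W - f ` N))"
    using a fin by (intro card_insert_disjoint) auto
  moreover have "card (f ` ?W) - card (f ` N) \<le> card (f ` ?W - f ` N)"
    using fin by (intro diff_card_le_card_Diff) auto
  moreover have "card (f ` N) \<le> card N"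
    using fin by (intro card_image_le)
  ultimately show ?thesis
    using f(2) unfolding N_def by linarith
qed

lemma card_neighbors_le_max_degree:
  assumes "v \<in> pverts G"
  shows "card {u. (v, u) \<in> parcs G} \<le> max_degree G"
proof -
  have "out_arcs (with_proj G) v = Pair v ` {u. (v, u) \<in> parcs G}"
    by (auto simp: out_arcs_def)
  then have "card {u. (v, u) \<in> parcs G} = out_degree (with_proj G) v"
    by (simp add: out_degree_def card_image inj_on_def)
  also have "\<dots> \<le> max_degree G"
    unfolding max_degree_def using assms pair_finite_verts by (intro Max_ge) auto
  finally show ?thesis .
qed

text \<open>The color classes of the neighbors are disjoint. Divided by the palette size, the sum is
  the expected number of neighbors that have the random new color.\<close>

lemma sum_card_neighbors_colored_le:
  assumes "v \<in> pverts G"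
  shows "(\<Sum>c\<in>palette G. card {u. (v, u) \<in> parcs G \<and> \<phi> u = c}) \<le> max_degree G"
proof -
  let ?N = "{u. (v, u) \<in> parcs G}"
  have fin: "finite ?N"
    using pair_finite_verts by (auto intro: finite_subset[of _ "pverts G"] dest: in_arcsD2)
  have "(\<Sum>c\<in>palette G. card {u. (v, u) \<in> parcs G \<and> \<phi> u = c})
      = card (\<Union>c\<in>palette G. {u. (v, u) \<in> parcs G \<and> \<phi> u = c})"
    using fin by (subst card_UN_disjoint) (auto simp: palette_def)
  also have "\<dots> \<le> card ?N"
    using fin by (intro card_mono) auto
  finally show ?thesis
    using card_neighbors_le_max_degree[OF assms] by linarith
qed

text \<open>The expected decrease of at least 1/(\<Delta> + 1), multiplied by the palette size to
  stay in the natural numbers.\<close>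

lemma defect_drift:
  assumes v: "v \<in> conflicted G \<phi>"
  shows "(\<Sum>c\<in>palette G. defect G (\<phi>(v := c))) + 1 \<le> (max_degree G + 1) * defect G \<phi>"
proof -
  let ?k = "mono_components G (pverts G - {v}) \<phi>"
  let ?d = "\<lambda>c. card {u. (v, u) \<in> parcs G \<and> \<phi> u = c}"
  have vV: "v \<in> pverts G" using v conflicted_subset by auto
  have k: "?k + 1 \<le> card (pverts G)"
    using mono_components_le_card[of "pverts G - {v}" G \<phi>] vV pair_finite_verts
      card_gt_0_iff[of "pverts G"] by fastforce
  \<comment> \<open>\<open>m\<close> bounds the new defect for a color that no neighbor has; by
    \<open>k\<close> the subtraction does not truncate.\<close>
  define m where "m = card (pverts G) - (?k + 1)"
  have "defect G (\<phi>(v := c)) \<le> m + ?d c" for c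
    using mono_components_insert[OF vV, of \<phi> c] k by (simp add: defect_def m_def)
  then have "(\<Sum>c\<in>palette G. defect G (\<phi>(v := c))) \<le> (\<Sum>c\<in>palette G. m + ?d c)"
    by (intro sum_mono)
  also have "\<dots> \<le> (max_degree G + 1) * m + max_degree G"
    using sum_card_neighbors_colored_le[OF vV, of \<phi>] by (simp add: sum.distrib palette_def)
  \<comment> \<open>The palette has one color more than the maximum degree; this surplus is the
    \<open>+ 1\<close>.\<close>
  finally have "(\<Sum>c\<in>palette G. defect G (\<phi>(v := c))) + 1 \<le> (max_degree G + 1) * (m + 1)"
    by simp
  also have "m + 1 \<le> defect G \<phi>"
    using mono_components_delete_conflicted[OF v] k by (simp add: defect_def m_def)
  then have "(max_degree G + 1) * (m + 1) \<le> (max_degree G + 1) * defect G \<phi>"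
    by (rule mult_le_mono2)
  finally show ?thesis .
qed

text \<open>Treats the case in which n(\<Delta> + 1) is not bounded by a multiple of
  n\<Delta>.\<close>

lemma conflicted_empty_if_max_degree_0:
  assumes "max_degree G = 0"
  shows "conflicted G \<phi> = {}"
proof -
  have "(v, u) \<notin> parcs G" for v u
  proof
    assume vu: "(v, u) \<in> parcs G"
    have "finite {u. (v, u) \<in> parcs G}"
      using pair_finite_verts by (auto intro: finite_subset[of _ "pverts G"] dest: in_arcsD2)
    then show False
      using card_neighbors_le_max_degree[OF in_arcsD1[OF vu]] assms vu by auto
  qed
  then show ?thesis by (simp add: conflicted_def)
qed

end

subsection \<open>Runs against an adversary\<close>

locale coloring_game = pair_graph G for G :: "'a pair_pre_digraph" +
  fixes \<phi>\<^sub>0 :: "'a \<Rightarrow> nat" and \<sigma> :: "'a adversary"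
  assumes coloring_initial: "coloring G \<phi>\<^sub>0"
    and legal: "legal_adversary G \<phi>\<^sub>0 \<sigma>"
begin

abbreviation conflicts :: "'a history \<Rightarrow> 'a set" where
  "conflicts h \<equiv> conflicted G (coloring_after \<phi>\<^sub>0 h)"

text \<open>An arbitrary starting history lets an induction peel off the first color. The index into
  the stream counts steps since \<open>h\<close>, not the length of the history.\<close>

primrec run_from :: "'a history \<Rightarrow> nat stream \<Rightarrow> nat \<Rightarrow> 'a history" where
  "run_from h \<omega> 0 = h"
| "run_from h \<omega> (Suc t) =
     (let h' = run_from h \<omega> t in if conflicts h' = {} then h' else h' @ [(\<sigma> h', \<omega> !! t)])"

section \<open>Decomposition at the first step and measurability\<close>

lemma run_eq_run_from: "run G \<phi>\<^sub>0 \<sigma> \<omega> t = run_from [] \<omega> t"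
  by (induction t) simp_all

lemma run_from_Suc_left:
  "run_from h \<omega> (Suc t) =
     (if conflicts h = {} then h else run_from (h @ [(\<sigma> h, shd \<omega>)]) (stl \<omega>) t)"
proof (induction t)
  case (Suc t)
  show ?case
    by (subst run_from.simps(2), subst Suc.IH) (auto simp: Let_def)
qed simp

lemma run_from_cong:
  assumes "stake t \<omega> = stake t \<omega>'"
  shows "run_from h \<omega> t = run_from h \<omega>' t"
  using assms
proof (induction t)
  case (Suc t)
  then show ?case
    by (simp only: stake_Suc append1_eq_conv run_from.simps)
qed simp

lemma coloring_after_snoc: "coloring_after \<phi>\<^sub>0 (h @ [(v, c)]) = (coloring_after \<phi>\<^sub>0 h)(v := c)"
  by (simp add: coloring_after_def)

lemma card_palette: "card (palette G) = max_degree G + 1"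
  by (simp add: palette_def)

lemma prob_space_color_stream: "prob_space (color_stream G)"
  unfolding color_stream_def by (rule prob_space.prob_space_stream_space[OF measure_pmf.prob_space_axioms])

lemma borel_measurable_length_run_from [measurable]:
  "(\<lambda>\<omega>. of_nat (length (run_from h \<omega> t)) :: ennreal) \<in> borel_measurable (color_stream G)"
proof -
  \<comment> \<open>Padding the first \<open>t\<close> colors with zeros makes the length a function
    of a finite list, and every function on the discrete space of lists is measurable.\<close>
  have eq: "run_from h \<omega> t = run_from h (stake t \<omega> @- sconst 0) t" for \<omega>
    by (rule run_from_cong) (simp add: stake_shift)
  have "stake t \<in> color_stream G \<rightarrow>\<^sub>M count_space UNIV"
    unfolding color_stream_def by (subst measurable_cong_sets[OF sets_stream_space_cong refl,
        of _ "count_space UNIV"]) (simp_all add: measurable_stake)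
  then have "(\<lambda>\<omega>. of_nat (length (run_from h (stake t \<omega> @- sconst 0) t)) :: ennreal)
      \<in> borel_measurable (color_stream G)"
    by (rule measurable_compose) simp
  then show ?thesis by (subst eq)
qed

text \<open>The first color is uniform and independent of the tail, which has the law of the whole
  stream.\<close>

lemma nn_integral_color_stream:
  assumes "f \<in> borel_measurable (color_stream G)"
  shows "(\<integral>\<^sup>+ \<omega>. f \<omega> \<partial>color_stream G)
    = (\<Sum>c\<in>palette G. \<integral>\<^sup>+ \<omega>. f (c ## \<omega>) \<partial>color_stream G) / of_nat (max_degree G + 1)"
proof -
  have "palette G \<noteq> {}" "finite (palette G)"
    by (auto simp: palette_def)
  then show ?thesis
    using card_palette assms
      prob_space.nn_integral_stream_space[OF measure_pmf.prob_space_axioms,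
        of f "pmf_of_set (palette G)"]
    by (simp add: color_stream_def nn_integral_pmf_of_set)
qed

text \<open>The right-hand side is a supermartingale: a recoloring adds 1 to the length and lowers
  the scaled defect by at least 1 on average. The induction conditions on the first color.\<close>

lemma expected_length_run_from_le:
  "(\<integral>\<^sup>+ \<omega>. of_nat (length (run_from h \<omega> t)) \<partial>color_stream G)
    \<le> of_nat (length h + (max_degree G + 1) * defect G (coloring_after \<phi>\<^sub>0 h))"
proof (induction t arbitrary: h)
  case 0
  interpret prob_space "color_stream G" by (rule prob_space_color_stream)
  show ?case by (simp add: emeasure_space_1)
next
  case (Suc t)
  interpret prob_space "color_stream G" by (rule prob_space_color_stream)
  let ?\<phi> = "coloring_after \<phi>\<^sub>0 h" and ?D = "max_degree G + 1"
  show ?case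
  proof (cases "conflicts h = {}")
    case True
    then show ?thesis
      by (simp add: run_from_Suc_left emeasure_space_1 del: run_from.simps)
  next
    case False
    then have "\<sigma> h \<in> conflicts h"
      using legal by (simp add: legal_adversary_def)
    then have "(\<Sum>c\<in>palette G. defect G (?\<phi>(\<sigma> h := c))) + 1 \<le> ?D * defect G ?\<phi>"
      by (rule defect_drift)
    then have "?D * ((\<Sum>c\<in>palette G. defect G (?\<phi>(\<sigma> h := c))) + 1 + length h)
        \<le> ?D * (?D * defect G ?\<phi> + length h)"
      by (intro mult_le_mono2 add_right_mono)
    then have drift: "(\<Sum>c\<in>palette G. length h + 1 + ?D * defect G (?\<phi>(\<sigma> h := c)))
        \<le> ?D * (length h + ?D * defect G ?\<phi>)"
      using card_palette
      by (simp only: sum.distrib sum_distrib_left[symmetric] sum_constant) (simp add: algebra_simps)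
    have "(\<integral>\<^sup>+ \<omega>. of_nat (length (run_from h \<omega> (Suc t))) \<partial>color_stream G)
        = (\<Sum>c\<in>palette G. \<integral>\<^sup>+ \<omega>. of_nat (length (run_from (h @ [(\<sigma> h, c)]) \<omega> t)) \<partial>color_stream G)
          / of_nat ?D"
      using False by (subst nn_integral_color_stream[OF borel_measurable_length_run_from[of h "Suc t"]])
        (simp add: run_from_Suc_left del: run_from.simps)
    also have "\<dots> \<le> (\<Sum>c\<in>palette G.
        of_nat (length h + 1 + ?D * defect G (?\<phi>(\<sigma> h := c)))) / of_nat ?D"
      \<comment> \<open>The induction hypothesis is applied to the history extended by the first
        recoloring.\<close>
      by (intro divide_right_mono_ennreal sum_mono Suc.IH
          [of "h @ [(\<sigma> h, _)]", unfolded coloring_after_snoc length_append_singleton Suc_eq_plus1])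
    also have "\<dots> \<le> of_nat (?D * (length h + ?D * defect G ?\<phi>)) / of_nat ?D"
      unfolding of_nat_sum[symmetric] using drift by (intro divide_right_mono_ennreal of_nat_mono)
    also have "\<dots> = of_nat (length h + ?D * defect G ?\<phi>)"
      unfolding of_nat_mult[of ?D] mult.commute[of "of_nat ?D"]
      by (rule ennreal_mult_divide_eq) (auto simp del: of_nat_Suc of_nat_add)
    finally show ?thesis .
  qed
qed

section \<open>From truncated runs to the total number of recolorings\<close>

lemma incseq_length_run:
  "incseq (\<lambda>t \<omega>. of_nat (length (run G \<phi>\<^sub>0 \<sigma> \<omega> t)) :: ennreal)"
  by (intro incseq_SucI le_funI of_nat_mono) (simp add: Let_def)

lemma borel_measurable_recolorings [measurable]:
  "recolorings G \<phi>\<^sub>0 \<sigma> \<in> borel_measurable (color_stream G)"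
  unfolding recolorings_def[abs_def] run_eq_run_from by measurable

lemma expected_recolorings_le_defect:
  "(\<integral>\<^sup>+ \<omega>. recolorings G \<phi>\<^sub>0 \<sigma> \<omega> \<partial>color_stream G)
    \<le> of_nat ((max_degree G + 1) * defect G \<phi>\<^sub>0)"
proof -
  have "(\<integral>\<^sup>+ \<omega>. recolorings G \<phi>\<^sub>0 \<sigma> \<omega> \<partial>color_stream G)
      = (SUP t. \<integral>\<^sup>+ \<omega>. of_nat (length (run G \<phi>\<^sub>0 \<sigma> \<omega> t)) \<partial>color_stream G)"
    unfolding recolorings_def
    by (intro nn_integral_monotone_convergence_SUP incseq_length_run)
      (simp add: run_eq_run_from borel_measurable_length_run_from)
  also have "\<dots> \<le> of_nat ((max_degree G + 1) * defect G \<phi>\<^sub>0)"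
    using expected_length_run_from_le[of "[]"]
    by (intro SUP_least) (simp add: run_eq_run_from coloring_after_def)
  finally show ?thesis .
qed

lemma expected_recolorings_le:
  "(\<integral>\<^sup>+ \<omega>. recolorings G \<phi>\<^sub>0 \<sigma> \<omega> \<partial>color_stream G)
    \<le> of_nat (2 * card (pverts G) * max_degree G)"
proof (cases "max_degree G = 0")
  case True
  then have "run G \<phi>\<^sub>0 \<sigma> \<omega> t = []" for \<omega> t
    by (induction t) (simp_all add: conflicted_empty_if_max_degree_0)
  then show ?thesis
    by (simp add: recolorings_def)
next
  case False
  \<comment> \<open>The constant 2 comes from \<Delta> + 1 \<le> 2\<Delta> for \<Delta> \<ge>
    1.\<close>
  have "(max_degree G + 1) * defect G \<phi>\<^sub>0 \<le> (2 * max_degree G) * card (pverts G)"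
    using False by (intro mult_le_mono) (auto simp: defect_def)
  then have "(max_degree G + 1) * defect G \<phi>\<^sub>0 \<le> 2 * card (pverts G) * max_degree G"
    by (simp add: mult_ac)
  then show ?thesis
    using expected_recolorings_le_defect by (meson of_nat_mono order_trans)
qed

lemma coloring_coloring_at:
  assumes "stream_all (\<lambda>c. c \<in> palette G) \<omega>"
  shows "coloring G (coloring_at G \<phi>\<^sub>0 \<sigma> \<omega> t)"
proof (induction t)
  case 0
  then show ?case using coloring_initial by (simp add: coloring_at_def coloring_after_def)
next
  case (Suc t)
  then show ?case
    using assms
    by (auto simp: coloring_at_def coloring_def coloring_after_snoc Let_def stream_all_def)
qed

text \<open>A run that never stops has length \<open>t\<close> at every time \<open>t\<close>, so
  the supremum is infinite.\<close>

lemma run_stops: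
  assumes "recolorings G \<phi>\<^sub>0 \<sigma> \<omega> \<noteq> \<infinity>"
  obtains T where "conflicts (run G \<phi>\<^sub>0 \<sigma> \<omega> T) = {}"
proof -
  have "\<exists>T. conflicts (run G \<phi>\<^sub>0 \<sigma> \<omega> T) = {}"
  proof (rule ccontr)
    assume no: "\<nexists>T. conflicts (run G \<phi>\<^sub>0 \<sigma> \<omega> T) = {}"
    have "length (run G \<phi>\<^sub>0 \<sigma> \<omega> t) = t" for t
      using no by (induction t) (auto simp: Let_def)
    then have "recolorings G \<phi>\<^sub>0 \<sigma> \<omega> = \<infinity>"
      by (simp add: recolorings_def ennreal_SUP_of_nat_eq_top)
    with assms show False by simp
  qed
  then show thesis using that by blast
qed

text \<open>Finite expectation forces almost every run to stop, after which its coloring is frozen.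
  Streams with entries outside the palette form a null set.\<close>

lemma AE_converges:
  "AE \<omega> in color_stream G. \<exists>\<phi>. proper_coloring G \<phi> \<and>
     (\<forall>\<^sub>F t in sequentially. coloring_at G \<phi>\<^sub>0 \<sigma> \<omega> t = \<phi>)"
proof -
  have "AE \<omega> in color_stream G. stream_all (\<lambda>c. c \<in> palette G) \<omega>"
    unfolding color_stream_def
    by (intro prob_space.AE_stream_all[OF measure_pmf.prob_space_axioms]) (auto simp: AE_measure_pmf_iff palette_def)
  moreover have "AE \<omega> in color_stream G. recolorings G \<phi>\<^sub>0 \<sigma> \<omega> \<noteq> \<infinity>"
  proof (intro nn_integral_PInf_AE borel_measurable_recolorings)
    show "(\<integral>\<^sup>+ \<omega>. recolorings G \<phi>\<^sub>0 \<sigma> \<omega> \<partial>color_stream G) \<noteq> \<infinity>"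
      unfolding infinity_ennreal_def
      by (rule less_imp_neq[OF le_less_trans[OF expected_recolorings_le of_nat_less_top]])
  qed
  ultimately show ?thesis
  proof eventually_elim
    case (elim \<omega>)
    obtain T where T: "conflicts (run G \<phi>\<^sub>0 \<sigma> \<omega> T) = {}"
      using run_stops[OF elim(2)] .
    have "run G \<phi>\<^sub>0 \<sigma> \<omega> t = run G \<phi>\<^sub>0 \<sigma> \<omega> T" if "t \<ge> T" for t
      using that by (induction t rule: dec_induct) (simp_all add: T)
    then have "coloring_at G \<phi>\<^sub>0 \<sigma> \<omega> t = coloring_at G \<phi>\<^sub>0 \<sigma> \<omega> T" if "t \<ge> T" for t
      unfolding coloring_at_def using that by metis
    then have "\<forall>\<^sub>F t in sequentially. coloring_at G \<phi>\<^sub>0 \<sigma> \<omega> t = coloring_at G \<phi>\<^sub>0 \<sigma> \<omega> T"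
      by (rule eventually_sequentiallyI)
    moreover have "proper_coloring G (coloring_at G \<phi>\<^sub>0 \<sigma> \<omega> T)"
      using T coloring_coloring_at[OF elim(1), of T]
      by (auto simp: proper_coloring_def conflicted_def coloring_at_def) (metis in_arcsD1)
    ultimately show ?case by blast
  qed
qed

end

theorem theorem2:
  shows "\<exists>C::real. C > 0 \<and>
    (\<forall>(G :: 'a pair_pre_digraph) (\<phi>\<^sub>0 :: 'a \<Rightarrow> nat) (\<sigma> :: 'a adversary).
       pair_graph G \<longrightarrow> coloring G \<phi>\<^sub>0 \<longrightarrow> legal_adversary G \<phi>\<^sub>0 \<sigma> \<longrightarrow>
         (AE \<omega> in color_stream G.
            \<exists>\<phi>. proper_coloring G \<phi> \<and>
                (\<forall>\<^sub>F t in sequentially. coloring_at G \<phi>\<^sub>0 \<sigma> \<omega> t = \<phi>)) \<and>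
         (\<integral>\<^sup>+ \<omega>. recolorings G \<phi>\<^sub>0 \<sigma> \<omega> \<partial>color_stream G)
           \<le> ennreal (C * real (card (pverts G)) * real (max_degree G)))"
proof (intro exI[of _ 2] conjI allI impI)
  fix G :: "'a pair_pre_digraph" and \<phi>\<^sub>0 :: "'a \<Rightarrow> nat" and \<sigma> :: "'a adversary"
  assume "pair_graph G" "coloring G \<phi>\<^sub>0" "legal_adversary G \<phi>\<^sub>0 \<sigma>"
  then interpret coloring_game G \<phi>\<^sub>0 \<sigma>
    by (intro coloring_game.intro coloring_game_axioms.intro)
  show "AE \<omega> in color_stream G. \<exists>\<phi>. proper_coloring G \<phi> \<and>
      (\<forall>\<^sub>F t in sequentially. coloring_at G \<phi>\<^sub>0 \<sigma> \<omega> t = \<phi>)"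
    by (rule AE_converges)
  show "(\<integral>\<^sup>+ \<omega>. recolorings G \<phi>\<^sub>0 \<sigma> \<omega> \<partial>color_stream G)
      \<le> ennreal (2 * real (card (pverts G)) * real (max_degree G))"
    using expected_recolorings_le by (simp add: ennreal_of_nat_eq_real_of_nat)
qed simp

end
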